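(* Let $L$ be an MV-algebra and $a\in B(L)$. Then the MV-algebras $(Fix_{d_{a^\ast}}(L),\oplus,\neg_2,0,a^\ast)$ and $(Fix_{g_a}(L),\oplus,\circ_1,a,1)$ are isomorphic.
   Context: An MV-algebra is an algebra $(L,\oplus,{}^\ast,0)$ of type $(2,1,0)$ such that $(L,\oplus,0)$ is a commutative monoid, $(x^\ast)^\ast=x$, $0^\ast\oplus x=0^\ast$, and $(x^\ast\oplus y)^\ast\oplus y=(y^\ast\oplus x)^\ast\oplus x$ for all $x,y\in L$. Put $1=0^\ast$, $x\odot y=(x^\ast\oplus y^\ast)^\ast$, $x\ominus y=x\odot y^\ast$. The Boolean center is $B(L)=\{a\in L\mid a\oplus a=a\}$. For $a\in L$ define maps $L\to L$ by $d_{a^\ast}(x)=x\ominus a=x\odot a^\ast$ and $g_a(x)=a\oplus x$. For a map $f:L\to L$, $Fix_f(L)=\{x\in L\mid f(x)=x\}$. For $a\in B(L)$: $(Fix_{d_{a^\ast}}(L),\oplus,\neg_2,0,a^\ast)$ is the MV-algebra with the addition $\oplus$ of $L$, negation $\neg_2x=d_{a^\ast}(x^\ast)$, zero element $0$ and unit (top) $a^\ast$; $(Fix_{g_a}(L),\oplus,\circ_1,a,1)$ is the MV-algebra with the addition $\oplus$ of $L$, negation $x^{\circ_1}=g_a(x^\ast)$, zero element $a$ and unit (top) $1$. *)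

theory Defs
  imports "HOL-Algebra.Congruence"
begin

record 'a mv_structure = "'a partial_object" +
  mv_add :: "'a \<Rightarrow> 'a \<Rightarrow> 'a" (infixl \<open>\<oplus>\<index>\<close> 65)
  mv_neg :: "'a \<Rightarrow> 'a" (\<open>\<sim>\<index> _\<close> [81] 80)
  mv_zero :: "'a" (\<open>\<zero>\<index>\<close>)

locale mv_algebra =
  fixes L :: "('a, 'm) mv_structure_scheme" (structure)
  assumes add_closed [simp, intro]: "\<lbrakk>x \<in> carrier L; y \<in> carrier L\<rbrakk> \<Longrightarrow> x \<oplus> y \<in> carrier L"
    and neg_closed [simp, intro]: "x \<in> carrier L \<Longrightarrow> \<sim> x \<in> carrier L"
    and zero_closed [simp, intro]: "\<zero> \<in> carrier L"
    and add_assoc: "\<lbrakk>x \<in> carrier L; y \<in> carrier L; z \<in> carrier L\<rbrakk>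
      \<Longrightarrow> (x \<oplus> y) \<oplus> z = x \<oplus> (y \<oplus> z)"
    and add_comm: "\<lbrakk>x \<in> carrier L; y \<in> carrier L\<rbrakk> \<Longrightarrow> x \<oplus> y = y \<oplus> x"
    and add_zero: "x \<in> carrier L \<Longrightarrow> x \<oplus> \<zero> = x"
    and neg_neg [simp]: "x \<in> carrier L \<Longrightarrow> \<sim> (\<sim> x) = x"
    and add_top: "x \<in> carrier L \<Longrightarrow> \<sim> \<zero> \<oplus> x = \<sim> \<zero>"
    and mv_axiom: "\<lbrakk>x \<in> carrier L; y \<in> carrier L\<rbrakk>
      \<Longrightarrow> \<sim> (\<sim> x \<oplus> y) \<oplus> y = \<sim> (\<sim> y \<oplus> x) \<oplus> x"

definition mv_one :: "('a, 'm) mv_structure_scheme \<Rightarrow> 'a" (\<open>\<one>\<index>\<close>)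
  where "\<one>\<^bsub>L\<^esub> = \<sim>\<^bsub>L\<^esub> \<zero>\<^bsub>L\<^esub>"

definition mv_odot :: "('a, 'm) mv_structure_scheme \<Rightarrow> 'a \<Rightarrow> 'a \<Rightarrow> 'a" (infixl \<open>\<odot>\<index>\<close> 70)
  where "x \<odot>\<^bsub>L\<^esub> y = \<sim>\<^bsub>L\<^esub> (\<sim>\<^bsub>L\<^esub> x \<oplus>\<^bsub>L\<^esub> \<sim>\<^bsub>L\<^esub> y)"

definition boolean_center :: "('a, 'm) mv_structure_scheme \<Rightarrow> 'a set"
  where "boolean_center L = {a \<in> carrier L. a \<oplus>\<^bsub>L\<^esub> a = a}"

text \<open>The index of the map \<open>d\<close> is the element one multiplies with, so the map
  \<open>x \<mapsto> x \<ominus> a\<close> is \<open>mv_d L (\<sim>\<^bsub>L\<^esub> a)\<close>.\<close>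

definition mv_d :: "('a, 'm) mv_structure_scheme \<Rightarrow> 'a \<Rightarrow> 'a \<Rightarrow> 'a"
  where "mv_d L b x = x \<odot>\<^bsub>L\<^esub> b"

definition mv_g :: "('a, 'm) mv_structure_scheme \<Rightarrow> 'a \<Rightarrow> 'a \<Rightarrow> 'a"
  where "mv_g L a x = a \<oplus>\<^bsub>L\<^esub> x"

definition Fix :: "('a, 'm) mv_structure_scheme \<Rightarrow> ('a \<Rightarrow> 'a) \<Rightarrow> 'a set"
  where "Fix L f = {x \<in> carrier L. f x = x}"

text \<open>The top element of an MV-algebra is determined by the other operations and is therefore
  not a component of the record; lemmas \<open>fix_d_one\<close> and \<open>fix_g_one\<close> below identify
  it in the two algebras of fixed points.\<close>

definition fix_d_algebra :: "('a, 'm) mv_structure_scheme \<Rightarrow> 'a \<Rightarrow> 'a mv_structure"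
  where "fix_d_algebra L a =
    \<lparr>carrier = Fix L (mv_d L (\<sim>\<^bsub>L\<^esub> a)),
     mv_add = (\<oplus>\<^bsub>L\<^esub>),
     mv_neg = (\<lambda>x. mv_d L (\<sim>\<^bsub>L\<^esub> a) (\<sim>\<^bsub>L\<^esub> x)),
     mv_zero = \<zero>\<^bsub>L\<^esub>\<rparr>"

definition fix_g_algebra :: "('a, 'm) mv_structure_scheme \<Rightarrow> 'a \<Rightarrow> 'a mv_structure"
  where "fix_g_algebra L a =
    \<lparr>carrier = Fix L (mv_g L a),
     mv_add = (\<oplus>\<^bsub>L\<^esub>),
     mv_neg = (\<lambda>x. mv_g L a (\<sim>\<^bsub>L\<^esub> x)),
     mv_zero = a\<rparr>"

definition mv_hom ::
    "('a, 'm) mv_structure_scheme \<Rightarrow> ('b, 'n) mv_structure_scheme \<Rightarrow> ('a \<Rightarrow> 'b) set"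
  where "mv_hom A B = {f.
    (\<forall>x \<in> carrier A. f x \<in> carrier B) \<and>
    (\<forall>x \<in> carrier A. \<forall>y \<in> carrier A. f (x \<oplus>\<^bsub>A\<^esub> y) = f x \<oplus>\<^bsub>B\<^esub> f y) \<and>
    (\<forall>x \<in> carrier A. f (\<sim>\<^bsub>A\<^esub> x) = \<sim>\<^bsub>B\<^esub> (f x)) \<and>
    f \<zero>\<^bsub>A\<^esub> = \<zero>\<^bsub>B\<^esub>}"

definition mv_isomorphic ::
    "('a, 'm) mv_structure_scheme \<Rightarrow> ('b, 'n) mv_structure_scheme \<Rightarrow> bool"
  where "mv_isomorphic A B \<longleftrightarrow> (\<exists>f \<in> mv_hom A B. bij_betw f (carrier A) (carrier B))"

text \<open>The two structures on fixed points are indeed MV-algebras: each is the image of \<open>L\<close>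
  under an idempotent map which preserves the operations.\<close>

lemma mv_algebra_image:
  assumes L: "mv_algebra L"
    and carr: "carrier M = h ` carrier L"
    and add: "\<And>x y. \<lbrakk>x \<in> carrier L; y \<in> carrier L\<rbrakk> \<Longrightarrow> h x \<oplus>\<^bsub>M\<^esub> h y = h (x \<oplus>\<^bsub>L\<^esub> y)"
    and neg: "\<And>x. x \<in> carrier L \<Longrightarrow> \<sim>\<^bsub>M\<^esub> (h x) = h (\<sim>\<^bsub>L\<^esub> x)"
    and zero: "\<zero>\<^bsub>M\<^esub> = h \<zero>\<^bsub>L\<^esub>"
  shows "mv_algebra M"
proof -
  interpret mv_algebra L by (rule L)
  show ?thesis
  proof (unfold_locales, unfold carr zero, safe, goal_cases)
    case (4 _ _ _ x y z)
    then show ?case by (simp add: add add_assoc)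
  next
    case (5 _ _ x y)
    then show ?case by (simp add: add add_comm[of x y])
  next
    case (8 _ x) then show ?case by (simp add: neg add add_top)
  next
    case (9 _ _ x y)
    then show ?case using mv_axiom[of x y] by (simp add: neg add)
  qed (auto simp: add neg add_zero)
qed

context mv_algebra
begin

lemma add_left_comm:
  "\<lbrakk>x \<in> carrier L; y \<in> carrier L; z \<in> carrier L\<rbrakk> \<Longrightarrow> x \<oplus> (y \<oplus> z) = y \<oplus> (x \<oplus> z)"
  by (metis add_assoc add_comm)

lemma odot_closed [simp, intro]: "\<lbrakk>x \<in> carrier L; y \<in> carrier L\<rbrakk> \<Longrightarrow> x \<odot> y \<in> carrier L"
  by (simp add: mv_odot_def)

lemma add_neg: "x \<in> carrier L \<Longrightarrow> x \<oplus> \<sim> x = \<sim> \<zero>"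
  using mv_axiom[of x "\<sim> \<zero>"] by (metis add_comm add_top add_zero neg_closed neg_neg zero_closed)

definition leq :: "'a \<Rightarrow> 'a \<Rightarrow> bool" where "leq x y \<longleftrightarrow> \<sim> x \<oplus> y = \<sim> \<zero>"

lemma leq_antisym:
  assumes "x \<in> carrier L" "y \<in> carrier L" "leq x y" "leq y x"
  shows "x = y"
  using assms mv_axiom[of x y] unfolding leq_def
  by (metis add_comm add_zero neg_neg zero_closed)

lemma leqI: "\<lbrakk>x \<in> carrier L; z \<in> carrier L\<rbrakk> \<Longrightarrow> leq x (x \<oplus> z)"
  unfolding leq_def by (metis add_assoc add_comm add_neg add_top neg_closed)

lemma leqE:
  assumes "x \<in> carrier L" "y \<in> carrier L" "leq x y"
  obtains z where "z \<in> carrier L" "y = x \<oplus> z"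
proof
  show "\<sim> (\<sim> y \<oplus> x) \<in> carrier L" using assms by simp
  show "y = x \<oplus> \<sim> (\<sim> y \<oplus> x)"
    using assms mv_axiom[of x y] unfolding leq_def
    by (metis add_comm add_closed neg_closed add_zero neg_neg zero_closed)
qed

lemma leq_add_mono:
  assumes "x \<in> carrier L" "y \<in> carrier L" "u \<in> carrier L" "v \<in> carrier L" "leq x y" "leq u v"
  shows "leq (x \<oplus> u) (y \<oplus> v)"
proof -
  obtain z w where "z \<in> carrier L" "y = x \<oplus> z" "w \<in> carrier L" "v = u \<oplus> w"
    using assms leqE by metis
  then have "y \<oplus> v = (x \<oplus> u) \<oplus> (z \<oplus> w)"
    using assms by (simp add: add_assoc add_left_comm)
  then show ?thesis using assms \<open>z \<in> carrier L\<close> \<open>w \<in> carrier L\<close> leqI by simp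
qed

lemma leq_refl: "x \<in> carrier L \<Longrightarrow> leq x x"
  by (metis add_comm add_neg leq_def neg_closed)

lemma leq_trans:
  assumes "x \<in> carrier L" "y \<in> carrier L" "z \<in> carrier L" "leq x y" "leq y z"
  shows "leq x z"
  using assms by (metis add_assoc add_closed leqE leqI)

lemma residuation:
  "\<lbrakk>x \<in> carrier L; b \<in> carrier L; y \<in> carrier L\<rbrakk> \<Longrightarrow> leq (x \<odot> b) y \<longleftrightarrow> leq x (y \<oplus> \<sim> b)"
  unfolding leq_def mv_odot_def by (simp add: add_assoc add_comm[of y "\<sim> b"])

text \<open>For \<open>a\<close> in the Boolean center, the join of \<open>a\<close> and \<open>y\<close> is \<open>a \<oplus> y\<close>.\<close>

lemma boolean_join:
  assumes "a \<in> boolean_center L" "y \<in> carrier L"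
  shows "\<sim> (\<sim> y \<oplus> a) \<oplus> a = a \<oplus> y"
proof -
  have a: "a \<in> carrier L" "a \<oplus> a = a" using assms by (auto simp: boolean_center_def)
  let ?j = "\<sim> (\<sim> y \<oplus> a) \<oplus> a"
  have "leq y ?j"
    using a assms by (metis mv_axiom leqI add_closed neg_closed add_comm)
  then have "leq (a \<oplus> y) (a \<oplus> ?j)"
    using a assms by (intro leq_add_mono leq_refl) auto
  also have "a \<oplus> ?j = ?j"
    using a assms by (metis add_assoc add_comm add_closed neg_closed)
  finally have 1: "leq (a \<oplus> y) ?j" .
  have "leq (\<sim> (\<sim> y \<oplus> a)) y"
    unfolding leq_def using a assms
    by (metis add_assoc add_comm add_closed neg_closed neg_neg add_neg add_top)
  then have "leq ?j (y \<oplus> a)" using a assms by (intro leq_add_mono leq_refl) auto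
  then show ?thesis using 1 a assms by (metis leq_antisym add_comm add_closed neg_closed)
qed

context
  fixes a
  assumes a: "a \<in> boolean_center L"
begin

lemma center_carrier [simp]: "a \<in> carrier L" and center_idem: "a \<oplus> a = a"
  using a by (auto simp: boolean_center_def)

lemma g_add:
  "\<lbrakk>x \<in> carrier L; y \<in> carrier L\<rbrakk> \<Longrightarrow> mv_g L a x \<oplus> mv_g L a y = mv_g L a (x \<oplus> y)"
  unfolding mv_g_def by (metis add_assoc add_left_comm center_idem center_carrier add_closed)

lemma g_neg: "x \<in> carrier L \<Longrightarrow> mv_g L a (\<sim> (mv_g L a x)) = mv_g L a (\<sim> x)"
  unfolding mv_g_def using boolean_join[OF a, of "\<sim> x"] by (simp add: add_comm)

lemma g_Fix: "Fix L (mv_g L a) = mv_g L a ` carrier L"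
  by (force simp: Fix_def mv_g_def center_idem simp flip: add_assoc)

lemma d_eq: "x \<in> carrier L \<Longrightarrow> mv_d L (\<sim> a) x = \<sim> (mv_g L a (\<sim> x))"
  by (simp add: mv_d_def mv_g_def mv_odot_def add_comm)

lemma d_closed [simp]: "x \<in> carrier L \<Longrightarrow> mv_d L (\<sim> a) x \<in> carrier L"
  by (simp add: mv_d_def)

lemma d_idem: "x \<in> carrier L \<Longrightarrow> mv_d L (\<sim> a) (mv_d L (\<sim> a) x) = mv_d L (\<sim> a) x"
  using d_eq[of "mv_d L (\<sim> a) x"] d_closed[of x]
  by (simp add: d_eq) (simp add: mv_g_def center_idem flip: add_assoc)

lemma d_Fix: "Fix L (mv_d L (\<sim> a)) = mv_d L (\<sim> a) ` carrier L"
  by (force simp: Fix_def d_idem)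

lemma d_neg:
  assumes "x \<in> carrier L"
  shows "mv_d L (\<sim> a) (\<sim> (mv_d L (\<sim> a) x)) = mv_d L (\<sim> a) (\<sim> x)"
proof -
  have "mv_g L a x \<in> carrier L" "mv_g L a (\<sim> x) \<in> carrier L"
    using assms by (auto simp: mv_g_def)
  then show ?thesis using assms g_neg[of "\<sim> x"] by (simp add: d_eq)
qed

lemma d_add:
  assumes "x \<in> carrier L" "y \<in> carrier L"
  shows "mv_d L (\<sim> a) x \<oplus> mv_d L (\<sim> a) y = mv_d L (\<sim> a) (x \<oplus> y)"
proof (rule leq_antisym)
  let ?d = "mv_d L (\<sim> a)"
  have join: "?d z \<oplus> a = a \<oplus> z" if "z \<in> carrier L" for z
    using boolean_join[OF a that] that by (simp add: mv_d_def mv_odot_def)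
  have "?d x \<oplus> ?d y \<oplus> a = (?d x \<oplus> a) \<oplus> (?d y \<oplus> a)"
    using assms by (metis add_assoc add_left_comm center_idem center_carrier d_closed add_closed)
  then have sum: "?d x \<oplus> ?d y \<oplus> a = x \<oplus> y \<oplus> a"
    using assms
    by (metis add_assoc add_comm add_left_comm center_idem center_carrier add_closed join)
  then show "leq (?d (x \<oplus> y)) (?d x \<oplus> ?d y)"
    using assms residuation[of "x \<oplus> y" "\<sim> a" "?d x \<oplus> ?d y"] leqI[of "x \<oplus> y" a]
    by (simp add: mv_d_def)
  let ?D = "?d x \<oplus> ?d y" and ?S = "x \<oplus> y"
  have D: "?D \<in> carrier L" and S: "?S \<in> carrier L" using assms by auto
  have na: "leq (\<sim> a \<oplus> \<sim> a) (\<sim> a)"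
    unfolding leq_def using mv_axiom[of a "\<sim> a"] boolean_join[OF a, of "\<sim> a"]
    by (simp add: add_neg add_comm)
  have le1: "leq (?d z) z" if "z \<in> carrier L" for z
    using that residuation[of z "\<sim> a" z] leqI[of z a] by (simp add: mv_d_def)
  have le2: "leq (?d z) (\<sim> a)" if "z \<in> carrier L" for z
    using that leqI[of a "\<sim> z"] by (simp add: d_eq mv_g_def leq_def add_comm)
  have "leq ?D (\<sim> a \<oplus> \<sim> a)" using assms le2 by (intro leq_add_mono) auto
  then have "leq ?D (\<sim> a)" using na D leq_trans by (metis add_closed neg_closed center_carrier)
  then have "leq a (\<sim> ?D)" using D by (simp add: leq_def add_comm)
  then have "a \<oplus> \<sim> ?D = \<sim> ?D"
    using D by (metis add_assoc center_idem center_carrier leqE neg_closed)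
  moreover have "leq ?D ?S" using assms le1 by (intro leq_add_mono) auto
  then have "leq (\<sim> ?S) (\<sim> ?D)" using D S by (simp add: leq_def add_comm)
  then have "leq (a \<oplus> \<sim> ?S) (a \<oplus> \<sim> ?D)" using D S by (intro leq_add_mono leq_refl) auto
  ultimately show "leq ?D (?d ?S)"
    using D S by (simp add: leq_def d_eq mv_g_def add_comm)
qed (use assms in auto)

lemma mv_algebra_fix_d: "mv_algebra (fix_d_algebra L a)"
proof (rule mv_algebra_image[OF mv_algebra_axioms, where h = "mv_d L (\<sim> a)"])
  show "\<zero>\<^bsub>fix_d_algebra L a\<^esub> = mv_d L (\<sim> a) \<zero>"
    by (simp add: fix_d_algebra_def d_eq mv_g_def add_comm[of a] add_top)
qed (simp_all add: fix_d_algebra_def d_Fix d_add d_neg)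

lemma mv_algebra_fix_g: "mv_algebra (fix_g_algebra L a)"
proof (rule mv_algebra_image[OF mv_algebra_axioms, where h = "mv_g L a"])
  show "\<zero>\<^bsub>fix_g_algebra L a\<^esub> = mv_g L a \<zero>"
    by (simp add: fix_g_algebra_def mv_g_def add_zero)
qed (simp_all add: fix_g_algebra_def g_Fix g_add g_neg)

lemma fix_d_one: "\<one>\<^bsub>fix_d_algebra L a\<^esub> = \<sim> a"
  by (simp add: mv_one_def fix_d_algebra_def d_eq mv_g_def add_zero)

lemma fix_g_one: "\<one>\<^bsub>fix_g_algebra L a\<^esub> = \<one>"
  by (simp add: mv_one_def fix_g_algebra_def mv_g_def add_neg)

end
end
end

theory Submission
  imports Defs
begin

text \<open>The map \<open>g\<^sub>a\<close> restricts to the isomorphism and \<open>d\<close> to its inverse: both are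
  idempotent, and \<open>g\<^sub>a (d x) = g\<^sub>a x\<close> and \<open>d (g\<^sub>a x) = d x\<close> for all \<open>x\<close>.\<close>

context mv_algebra
begin

text \<open>By \<open>d_eq\<close>, \<open>d\<close> is \<open>g\<close> conjugated by negation, so
  this is \<open>g_neg\<close> at \<open>\<sim> x\<close>.\<close>

lemma g_d:
  assumes "a \<in> boolean_center L" "x \<in> carrier L"
  shows "mv_g L a (mv_d L (\<sim> a) x) = mv_g L a x"
  using assms g_neg[OF assms(1), of "\<sim> x"] by (simp add: d_eq)

lemma d_g:
  assumes "a \<in> boolean_center L" "x \<in> carrier L"
  shows "mv_d L (\<sim> a) (mv_g L a x) = mv_d L (\<sim> a) x"
proof -
  have "mv_g L a x \<in> carrier L"
    using assms by (simp add: mv_g_def center_carrier)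
  then show ?thesis
    using assms by (simp add: d_eq g_neg)
qed

text \<open>For negation, both sides reduce to \<open>mv_g L a (\<sim> x)\<close>: the source side
  by \<open>g_d\<close>, the target side by \<open>g_neg\<close>.\<close>

lemma g_hom:
  assumes a: "a \<in> boolean_center L"
  shows "mv_g L a \<in> mv_hom (fix_d_algebra L a) (fix_g_algebra L a)"
  using center_carrier[OF a]
  by (auto simp: mv_hom_def fix_d_algebra_def fix_g_algebra_def g_Fix[OF a] g_add[OF a]
      g_d[OF a] g_neg[OF a] Fix_def[of L "mv_d L (\<sim> a)"])
    (simp add: mv_g_def add_zero)

text \<open>By \<open>g_d\<close> and \<open>d_g\<close>, each round trip collapses to a single map,
  which is the identity on its own fixed points.\<close>

lemma g_bij:
  assumes a: "a \<in> boolean_center L"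
  shows "bij_betw (mv_g L a) (Fix L (mv_d L (\<sim> a))) (Fix L (mv_g L a))"
proof (rule bij_betw_byWitness[where f' = "mv_d L (\<sim> a)"])
  show "mv_g L a ` Fix L (mv_d L (\<sim> a)) \<subseteq> Fix L (mv_g L a)"
    \<comment> \<open>With the fixed points rewritten as an image, only membership of the arguments
      in \<open>carrier L\<close> is left.\<close>
    unfolding g_Fix[OF a] by (auto simp: Fix_def)
  show "mv_d L (\<sim> a) ` Fix L (mv_g L a) \<subseteq> Fix L (mv_d L (\<sim> a))"
    unfolding d_Fix[OF a] by (auto simp: Fix_def)
qed (auto simp: Fix_def g_d[OF a] d_g[OF a])

end

theorem theorem4p15:
  fixes L :: "('a, 'm) mv_structure_scheme" and a :: 'a
  assumes "mv_algebra L" and "a \<in> boolean_center L"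
  shows "mv_isomorphic (fix_d_algebra L a) (fix_g_algebra L a)"
proof -
  interpret mv_algebra L by (rule assms(1))
  show ?thesis
    unfolding mv_isomorphic_def
  proof (rule bexI[OF _ g_hom[OF assms(2)]])
    show "bij_betw (mv_g L a) (carrier (fix_d_algebra L a)) (carrier (fix_g_algebra L a))"
      using g_bij[OF assms(2)] by (simp add: fix_d_algebra_def fix_g_algebra_def)
  qed
qed

end
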